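(* Let $Y$ be a real random variable whose moment generating function $E[e^{tY}]$ exists for $|t|<\rho$ for some $\rho>0$. For all integers $n\ge r\ge 0$, $$D_{n}^{(r,Y)}= n!\sum_{l=r}^{n}\binom{l-1}{r-1}\frac{D_{n-l}^{Y}}{(n-l)!}.$$
   Context: For an integer $r\ge 0$, the probabilistic $r$-derangement numbers $D_n^{(r,Y)}$ ($n\ge r$) associated with $Y$ are defined by the generating function (for $t$ near $0$) $$\frac{t^{r}}{(1-t)^{r+1}}E\big[e^{-Yt}\big]=\sum_{n=r}^{\infty}D_{n}^{(r,Y)}\frac{t^{n}}{n!}.$$ The probabilistic derangement numbers $D_n^Y$ associated with $Y$ are defined by $$\frac{1}{1-t}E\big[e^{-tY}\big]=\sum_{n=0}^{\infty}D_{n}^{Y}\frac{t^{n}}{n!}.$$ Convention: for $l\ge r\ge 0$, $\binom{l-1}{r-1}$ denotes the coefficient of $t^l$ in $\left(\frac{t}{1-t}\right)^r$; this is the usual binomial coefficient when $r\ge 1$, while for $r=0$ it means $\binom{-1}{-1}=1$ and $\binom{l-1}{-1}=0$ for $l\ge 1$. *)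

theory Defs
  imports "HOL-Probability.Probability" "HOL-Computational_Algebra.Formal_Power_Series"
begin

text \<open>Both number sequences are the coefficients of an exponential generating function that
  represents the given function of \<open>t\<close> in some neighbourhood of \<open>0\<close>.\<close>

definition prob_derangement :: "'a measure \<Rightarrow> ('a \<Rightarrow> real) \<Rightarrow> nat \<Rightarrow> real" where
  "prob_derangement M Y = (THE D.
     \<forall>\<^sub>F t in nhds 0.
       (\<lambda>n. D n * t ^ n / fact n) sums
         (1 / (1 - t) * (\<integral>\<omega>. exp (- (t * Y \<omega>)) \<partial>M)))"

text \<open>The series starts at \<open>n = r\<close>, so it determines \<open>D n\<close> for \<open>n \<ge> r\<close> only. The values
  for \<open>n < r\<close> are set to \<open>0\<close> to make the sequence \<open>D\<close> unique.\<close>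

definition prob_r_derangement :: "'a measure \<Rightarrow> ('a \<Rightarrow> real) \<Rightarrow> nat \<Rightarrow> nat \<Rightarrow> real" where
  "prob_r_derangement M Y r = (THE D.
     (\<forall>n<r. D n = 0) \<and>
     (\<forall>\<^sub>F t in nhds 0.
       (\<lambda>k. D (k + r) * t ^ (k + r) / fact (k + r)) sums
         (t ^ r / (1 - t) ^ (r + 1) * (\<integral>\<omega>. exp (- (Y \<omega> * t)) \<partial>M))))"

text \<open>\<open>shifted_binomial l r\<close> is the binomial coefficient \<open>l - 1\<close> over \<open>r - 1\<close>, read as the
  coefficient of \<open>t ^ l\<close> in \<open>(t / (1 - t)) ^ r\<close>. Truncated subtraction in
  \<open>(l - 1) choose (r - 1)\<close> would give the wrong value \<open>1\<close> for \<open>r = 0\<close>, \<open>l \<ge> 1\<close>.\<close>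

definition shifted_binomial :: "nat \<Rightarrow> nat \<Rightarrow> real" where
  "shifted_binomial l r = fps_nth ((fps_X / (1 - fps_X)) ^ r) l"

lemma shifted_binomial_0: "shifted_binomial l 0 = (if l = 0 then 1 else 0)"
  by (simp add: shifted_binomial_def)

lemma shifted_binomial_eq_binomial:
  assumes "1 \<le> r" "r \<le> l"
  shows "shifted_binomial l r = real ((l - 1) choose (r - 1))"
proof -
  have "(fps_X / (1 - fps_X)) ^ r = (fps_X ^ r * inverse ((1 - fps_X) ^ r) :: real fps)"
    by (simp add: fps_divide_unit power_mult_distrib fps_inverse_power)
  also have "inverse ((1 - fps_X) ^ r) =
      Abs_fps (\<lambda>n. of_nat ((r + n - 1) choose n) :: real)"
    using one_minus_const_fps_X_neg_power'[of r "1 :: real"] assms by simp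
  finally have "shifted_binomial l r = real ((r + (l - r) - 1) choose (l - r))"
    using assms by (simp add: shifted_binomial_def fps_X_power_mult_nth)
  also have "(r + (l - r) - 1) choose (l - r) = (l - 1) choose (r - 1)"
    using assms by (subst binomial_symmetric) auto
  finally show ?thesis .
qed

end

theory Submission
  imports Defs
begin

text \<open>For \<open>t\<close> near \<open>0\<close> the expectation \<open>E[exp (- t Y)]\<close> is the sum of a convergent power series
  \<open>G\<close> in \<open>t\<close>: the partial sums of the exponential series are dominated by \<open>exp \<bar>t Y\<bar>\<close>, which is at most the
  integrable function \<open>exp (t Y) + exp (- t Y)\<close> (lemma \<open>mgf_has_fps_expansion\<close>). Hence the defining functions of the two
  sequences have the expansions \<open>G / (1 - X)\<close> and \<open>X\<^sup>r / (1 - X)\<^sup>r\<^sup>+\<^sup>1 G\<close>. Since a convergent power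
  series is determined by its sum near \<open>0\<close> (lemma \<open>has_fps_expansion_unique\<close>), the definite descriptions
  \<open>prob_derangement\<close> and \<open>prob_r_derangement\<close> denote \<open>n!\<close> times the coefficients of these
  two formal power series. The second series is \<open>(X / (1 - X))\<^sup>r\<close> times the first, so the theorem is
  the Cauchy product formula, whose terms with \<open>l < r\<close> vanish.\<close>

section \<open>Power series representing a function near zero\<close>

text \<open>If the difference \<open>F - G\<close>, an expansion of the zero function, were nonzero, then dividing it by
  its leading power of \<open>X\<close> would give a series that represents a function vanishing off \<open>0\<close> but with
  value \<open>c \<noteq> 0\<close> at \<open>0\<close>. Sums of convergent power series are continuous, a contradiction.\<close>

lemma has_fps_expansion_unique:
  fixes F G :: "'a :: {banach, real_normed_field} fps"
  assumes "f has_fps_expansion F" "f has_fps_expansion G"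
  shows "F = G"
proof (rule ccontr)
  assume "F \<noteq> G"
  define n c where "n = subdegree (F - G)" and "c = fps_nth (F - G) n"
  have "c \<noteq> 0"
    using \<open>F \<noteq> G\<close> unfolding c_def n_def by (metis nth_subdegree_nonzero right_minus_eq)
  have "(\<lambda>_. 0) has_fps_expansion F - G"
    using has_fps_expansion_diff[OF assms] by simp
  from has_fps_expansion_shift[OF this _ c_def]
  have "(\<lambda>x. if x = 0 then c else 0 / x ^ n) has_fps_expansion fps_shift n (F - G)"
    by (simp add: n_def)
  then have "continuous (at 0) (\<lambda>x. if x = 0 then c else 0 / x ^ n)"
    by (rule has_fps_expansion_imp_continuous)
  then have "(\<lambda>x :: 'a. if x = 0 then c else 0 / x ^ n) \<midarrow>0\<rightarrow> c"
    by (simp add: continuous_at)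
  moreover have "(\<lambda>x :: 'a. if x = 0 then c else 0 / x ^ n) \<midarrow>0\<rightarrow> 0"
    by (rule tendsto_eventually) (auto simp: eventually_at_filter)
  ultimately have "c = 0"
    by (rule LIM_unique)
  with \<open>c \<noteq> 0\<close> show False by simp
qed

lemma has_fps_expansion_power:
  fixes F :: "'a :: {banach, real_normed_div_algebra, comm_ring_1} fps"
  assumes "f has_fps_expansion F"
  shows "(\<lambda>x. f x ^ m) has_fps_expansion F ^ m"
  by (induction m) (auto intro!: has_fps_expansion_mult assms)

lemma has_fps_expansion_iff_sums:
  fixes F :: "'a :: {banach, real_normed_div_algebra} fps"
  shows "f has_fps_expansion F \<longleftrightarrow> (\<forall>\<^sub>F t in nhds 0. (\<lambda>n. fps_nth F n * t ^ n) sums f t)"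
proof
  assume F: "f has_fps_expansion F"
  have "\<forall>\<^sub>F t in nhds 0. t \<in> eball 0 (fps_conv_radius F)"
    using F by (intro eventually_nhds_in_open) (auto simp: has_fps_expansion_def zero_ereal_def)
  moreover have "\<forall>\<^sub>F t in nhds 0. eval_fps F t = f t"
    using F by (simp add: has_fps_expansion_def)
  ultimately show "\<forall>\<^sub>F t in nhds 0. (\<lambda>n. fps_nth F n * t ^ n) sums f t"
  proof eventually_elim
    case (elim t)
    then show ?case using sums_eval_fps[of t F] by simp
  qed
qed (rule has_fps_expansionI)

text \<open>Uniqueness turns the definite descriptions of sequences given by an exponential generating
  function into explicit coefficients.\<close>

lemma egf_sums_iff:
  fixes f :: "real \<Rightarrow> real"
  assumes "f has_fps_expansion F"
  shows "(\<forall>\<^sub>F t in nhds 0. (\<lambda>n. D n * t ^ n / fact n) sums f t)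
    \<longleftrightarrow> D = (\<lambda>n. fact n * fps_nth F n)"
proof -
  have "(\<forall>\<^sub>F t in nhds 0. (\<lambda>n. D n * t ^ n / fact n) sums f t)
      \<longleftrightarrow> f has_fps_expansion Abs_fps (\<lambda>n. D n / fact n)"
    by (simp add: has_fps_expansion_iff_sums)
  also have "\<dots> \<longleftrightarrow> Abs_fps (\<lambda>n. D n / fact n) = F"
    using assms has_fps_expansion_unique by blast
  also have "\<dots> \<longleftrightarrow> D = (\<lambda>n. fact n * fps_nth F n)"
    by (auto simp: fps_eq_iff fun_eq_iff field_simps)
  finally show ?thesis .
qed

section \<open>Expansion of the moment generating function\<close>

text \<open>Integrability at both \<open>t\<close> and \<open>-t\<close> yields an integrable bound for
  \<open>exp \<bar>t Y\<bar>\<close>. This bounds every partial sum of the series of absolute moments, which justifies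
  integrating the exponential series term by term.\<close>

lemma mgf_sums:
  fixes Y :: "'a \<Rightarrow> real"
  assumes [measurable]: "Y \<in> borel_measurable M"
    and int: "integrable M (\<lambda>\<omega>. exp (t * Y \<omega>))" "integrable M (\<lambda>\<omega>. exp (- (t * Y \<omega>)))"
  shows "(\<lambda>n. (\<integral>\<omega>. (- Y \<omega>) ^ n \<partial>M) / fact n * t ^ n) sums (\<integral>\<omega>. exp (- (t * Y \<omega>)) \<partial>M)"
proof -
  let ?f = "\<lambda>n \<omega>. (- (t * Y \<omega>)) ^ n / fact n"
  let ?B = "\<lambda>\<omega>. exp (t * Y \<omega>) + exp (- (t * Y \<omega>))"
  have B: "integrable M ?B"
    using int by simp
  have norm_f: "norm (?f n \<omega>) = \<bar>t * Y \<omega>\<bar> ^ n / fact n" for n \<omega>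
    by (simp add: power_abs)
  have exp_sums: "(\<lambda>n. x ^ n / fact n) sums exp x" for x :: real
    using exp_converges[of x] by (simp add: field_simps)
  have partial: "(\<Sum>i<n. norm (?f i \<omega>)) \<le> ?B \<omega>" for n \<omega>
  proof -
    have "(\<Sum>i<n. norm (?f i \<omega>)) \<le> exp \<bar>t * Y \<omega>\<bar>"
      unfolding norm_f sums_unique[OF exp_sums]
      by (intro sum_le_suminf) (auto intro: sums_summable[OF exp_sums])
    also have "\<dots> \<le> ?B \<omega>"
      by (cases "t * Y \<omega> \<ge> 0") (auto simp: abs_if)
    finally show ?thesis .
  qed
  have f_int: "integrable M (?f n)" for n
  proof (rule Bochner_Integration.integrable_bound[OF B])
    have "norm (?f n \<omega>) \<le> norm (?B \<omega>)" for \<omega>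
    proof -
      have "norm (?f n \<omega>) \<le> (\<Sum>i<Suc n. norm (?f i \<omega>))"
        by (rule member_le_sum) auto
      also have "\<dots> \<le> norm (?B \<omega>)"
        by (rule order_trans[OF partial]) simp
      finally show ?thesis .
    qed
    then show "AE \<omega> in M. norm (?f n \<omega>) \<le> norm (?B \<omega>)" by blast
  qed measurable
  have "(\<lambda>n. \<integral>\<omega>. ?f n \<omega> \<partial>M) sums (\<integral>\<omega>. (\<Sum>n. ?f n \<omega>) \<partial>M)"
  proof (rule sums_integral[OF f_int])
    show "AE \<omega> in M. summable (\<lambda>n. norm (?f n \<omega>))"
      unfolding norm_f by (intro always_eventually allI sums_summable[OF exp_sums])
    show "summable (\<lambda>n. \<integral>\<omega>. norm (?f n \<omega>) \<partial>M)"
    proof (rule summableI_nonneg_bounded)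
      fix n
      have "(\<Sum>i<n. \<integral>\<omega>. norm (?f i \<omega>) \<partial>M) = (\<integral>\<omega>. (\<Sum>i<n. norm (?f i \<omega>)) \<partial>M)"
        by (intro Bochner_Integration.integral_sum[symmetric] integrable_norm f_int)
      also have "\<dots> \<le> (\<integral>\<omega>. ?B \<omega> \<partial>M)"
        by (intro integral_mono B Bochner_Integration.integrable_sum integrable_norm f_int partial)
      finally show "(\<Sum>i<n. \<integral>\<omega>. norm (?f i \<omega>) \<partial>M) \<le> (\<integral>\<omega>. ?B \<omega> \<partial>M)" .
    qed simp
  qed
  moreover have "(\<Sum>n. ?f n \<omega>) = exp (- (t * Y \<omega>))" for \<omega>
    using exp_sums by (rule sums_unique[symmetric])
  moreover have "(\<integral>\<omega>. ?f n \<omega> \<partial>M) = (\<integral>\<omega>. (- Y \<omega>) ^ n \<partial>M) / fact n * t ^ n" for n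
  proof -
    have "?f n \<omega> = (t ^ n / fact n) * (- Y \<omega>) ^ n" for \<omega>
      by (simp flip: power_mult_distrib)
    then show ?thesis by simp
  qed
  ultimately show ?thesis by simp
qed

lemma mgf_has_fps_expansion:
  fixes Y :: "'a \<Rightarrow> real"
  assumes "Y \<in> borel_measurable M" "\<rho> > 0"
    and int: "\<And>t. \<bar>t\<bar> < \<rho> \<Longrightarrow> integrable M (\<lambda>\<omega>. exp (t * Y \<omega>))"
  shows "(\<lambda>t. \<integral>\<omega>. exp (- (t * Y \<omega>)) \<partial>M) has_fps_expansion
    Abs_fps (\<lambda>n. (\<integral>\<omega>. (- Y \<omega>) ^ n \<partial>M) / fact n)"
proof (rule has_fps_expansionI)
  have "\<forall>\<^sub>F t in nhds 0. t \<in> ball 0 \<rho>"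
    using assms(2) by (intro eventually_nhds_in_open) auto
  then show "\<forall>\<^sub>F t in nhds 0.
      (\<lambda>n. fps_nth (Abs_fps (\<lambda>n. (\<integral>\<omega>. (- Y \<omega>) ^ n \<partial>M) / fact n)) n * t ^ n) sums
        (\<integral>\<omega>. exp (- (t * Y \<omega>)) \<partial>M)"
  proof eventually_elim
    case (elim t)
    then have "\<bar>t\<bar> < \<rho>" by simp
    then show ?case
      using mgf_sums[OF assms(1) int[of t]] int[of "- t"] by simp
  qed
qed

section \<open>The two sequences as coefficients of formal power series\<close>

lemma has_fps_expansion_one_minus:
  "(\<lambda>t :: real. 1 - t) has_fps_expansion 1 - fps_X"
  by (intro has_fps_expansion_diff has_fps_expansion_1 has_fps_expansion_fps_X)

lemma prob_derangement_eq:
  assumes "(\<lambda>t. \<integral>\<omega>. exp (- (t * Y \<omega>)) \<partial>M) has_fps_expansion G"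
  shows "prob_derangement M Y n = fact n * fps_nth (1 / (1 - fps_X) * G) n"
proof -
  have "(\<lambda>t. 1 / (1 - t) * (\<integral>\<omega>. exp (- (t * Y \<omega>)) \<partial>M)) has_fps_expansion 1 / (1 - fps_X) * G"
    by (intro has_fps_expansion_mult has_fps_expansion_divide' has_fps_expansion_one_minus assms
        has_fps_expansion_1) simp
  from egf_sums_iff[OF this] show ?thesis
    unfolding prob_derangement_def by simp
qed

text \<open>Setting the values below \<open>r\<close> to \<open>0\<close> makes the series starting at \<open>r\<close> an ordinary
  exponential generating function. This is consistent with the expansion
  because \<open>X\<^sup>r\<close> divides it.\<close>

lemma prob_r_derangement_eq:
  assumes "(\<lambda>t. \<integral>\<omega>. exp (- (t * Y \<omega>)) \<partial>M) has_fps_expansion G"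
  shows "prob_r_derangement M Y r n = fact n * fps_nth (fps_X ^ r / (1 - fps_X) ^ (r + 1) * G) n"
proof -
  let ?F = "fps_X ^ r / (1 - fps_X) ^ (r + 1) * G"
  let ?f = "\<lambda>t. t ^ r / (1 - t) ^ (r + 1) * (\<integral>\<omega>. exp (- (Y \<omega> * t)) \<partial>M)"
  have "(\<lambda>t. \<integral>\<omega>. exp (- (Y \<omega> * t)) \<partial>M) has_fps_expansion G"
    using assms by (simp add: mult.commute)
  then have F: "?f has_fps_expansion ?F"
    by (intro has_fps_expansion_mult has_fps_expansion_divide' has_fps_expansion_power
        has_fps_expansion_one_minus has_fps_expansion_fps_X) (simp_all add: fps_power_zeroth)
  have zero: "fps_nth ?F k = 0" if "k < r" for k
  proof -
    have "fps_X ^ r / (1 - fps_X) ^ (r + 1) = fps_X ^ r * inverse ((1 - fps_X :: real fps) ^ (r + 1))"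
      by (rule fps_divide_unit) (simp add: fps_power_zeroth)
    then have "?F = fps_X ^ r * (inverse ((1 - fps_X) ^ (r + 1)) * G)"
      by (simp only: mult.assoc)
    then show ?thesis
      using that by (simp only: fps_X_power_mult_nth if_True)
  qed
  have "((\<forall>n<r. D n = 0) \<and>
      (\<forall>\<^sub>F t in nhds 0. (\<lambda>k. D (k + r) * t ^ (k + r) / fact (k + r)) sums ?f t))
    \<longleftrightarrow> D = (\<lambda>n. fact n * fps_nth ?F n)" for D
  proof -
    have "(\<lambda>k. D (k + r) * t ^ (k + r) / fact (k + r)) sums s
        \<longleftrightarrow> (\<lambda>n. D n * t ^ n / fact n) sums s" if "\<forall>n<r. D n = 0" for s t
      using that by (intro sums_zero_iff_shift) simp
    then show ?thesis
      using egf_sums_iff[OF F, of D] zero by auto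
  qed
  then show ?thesis
    unfolding prob_r_derangement_def by simp
qed

section \<open>The convolution formula\<close>

lemma shifted_binomial_eq_0:
  assumes "l < r"
  shows "shifted_binomial l r = 0"
proof -
  have "(fps_X / (1 - fps_X)) ^ r = (fps_X ^ r * inverse (1 - fps_X) ^ r :: real fps)"
    by (simp add: fps_divide_unit power_mult_distrib)
  then show ?thesis
    using assms by (simp add: shifted_binomial_def fps_X_power_mult_nth)
qed

theorem theorem2p6:
  fixes M :: "'a measure" and Y :: "'a \<Rightarrow> real" and \<rho> :: real and n r :: nat
  assumes "prob_space M"
    and "Y \<in> borel_measurable M"
    and "\<rho> > 0"
    and "\<And>t. \<bar>t\<bar> < \<rho> \<Longrightarrow> integrable M (\<lambda>\<omega>. exp (t * Y \<omega>))"
    and "r \<le> n"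
  shows "prob_r_derangement M Y r n =
    fact n * (\<Sum>l=r..n. shifted_binomial l r * (prob_derangement M Y (n - l) / fact (n - l)))"
proof -
  obtain G where G: "(\<lambda>t. \<integral>\<omega>. exp (- (t * Y \<omega>)) \<partial>M) has_fps_expansion G"
    using mgf_has_fps_expansion[OF assms(2-4)] by blast
  let ?H = "1 / (1 - fps_X) * G"
  have "fps_X ^ r / (1 - fps_X) ^ (r + 1) * G = (fps_X / (1 - fps_X)) ^ r * ?H"
    by (simp add: fps_divide_unit fps_power_zeroth power_mult_distrib fps_inverse_mult
        fps_inverse_power mult_ac)
  then have "prob_r_derangement M Y r n = fact n * fps_nth ((fps_X / (1 - fps_X)) ^ r * ?H) n"
    by (simp only: prob_r_derangement_eq[OF G])
  also have "fps_nth ((fps_X / (1 - fps_X)) ^ r * ?H) n =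
      (\<Sum>l=0..n. shifted_binomial l r * fps_nth ?H (n - l))"
    by (simp only: fps_mult_nth shifted_binomial_def)
  also have "\<dots> = (\<Sum>l=r..n. shifted_binomial l r * fps_nth ?H (n - l))"
    by (rule sum.mono_neutral_right) (auto simp: shifted_binomial_eq_0)
  also have "\<dots> = (\<Sum>l=r..n. shifted_binomial l r * (prob_derangement M Y (n - l) / fact (n - l)))"
    by (simp add: prob_derangement_eq[OF G])
  finally show ?thesis .
qed

end
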